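(* Let $\mathcal F$ be the unit $\ell_1$ ball of $\mathbb R^N$, $\mathcal X$ the unit $\ell_\infty$ ball of $\mathbb R^N$, and $\ell(f,x)=\langle f,x\rangle$. If $D$ is any symmetric distribution over the real line, then the Perturbation Assumption (stated in the context) is satisfied by using the product distribution $D^N$ as the distribution in it. The constant $C$ required is any $C\ge6/\mathbb E_{x\sim D}|x|$.
   Context: $\Delta(\mathcal X)$ is the set of probability distributions on $\mathcal X$. Perturbation Assumption (for linear loss, with $\mathcal X$ the unit ball of a norm $\|\cdot\|$, here $\|\cdot\|_\infty$, and $\mathcal F$ the unit ball of the dual norm): there exist a distribution $Q\in\Delta(\mathcal X)$ and a constant $C\ge2$ such that for any $t\in\{1,\dots,T\}$, any $x_1,\dots,x_{t-1},x_{t+1},\dots,x_T\in\mathcal X$ and any $\epsilon_{t+1},\dots,\epsilon_T\in\{\pm1\}$, $$\sup_{p\in\Delta(\mathcal X)}\mathbb E_{x_t\sim p}\Big\|C\sum_{i=t+1}^T\epsilon_ix_i-\sum_{i=1}^{t-1}x_i+\mathbb E_{x\sim p}[x]-x_t\Big\|\le\mathbb E_{\epsilon_t,\,x_t\sim Q}\Big\|C\sum_{i=t}^T\epsilon_ix_i-\sum_{i=1}^{t-1}x_i\Big\|,$$ where on the right-hand side $\epsilon_t$ is an independent Rademacher (uniform $\pm1$) random variable. For this inequality to hold it is enough that $\sup_{p\in\Delta(\mathcal X)}\mathbb E_{x_t\sim p}\|w+\mathbb E_{x\sim p}[x]-x_t\|\le\mathbb E_{\epsilon_t,\,x_t\sim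 Q}\|w+C\epsilon_tx_t\|$ for every vector $w$ of the space.
   Formalization: The inequality is proved for every symmetric D and every positive C ≥ 6/E|x|; the full Assumption, with D^N in Δ(X) and C ≥ 2, only for D supported on [-1,1], since otherwise D^N is not a distribution on X. *)

theory Defs
  imports "HOL-Probability.Probability"
begin

definition is_norm :: "('a::real_vector \<Rightarrow> real) \<Rightarrow> bool" where
  "is_norm nrm \<longleftrightarrow>
     (\<forall>x. 0 \<le> nrm x \<and> (nrm x = 0 \<longleftrightarrow> x = 0)) \<and>
     (\<forall>a x. nrm (a *\<^sub>R x) = \<bar>a\<bar> * nrm x) \<and>
     (\<forall>x y. nrm (x + y) \<le> nrm x + nrm y)"

definition dual_norm :: "('a::euclidean_space \<Rightarrow> real) \<Rightarrow> 'a \<Rightarrow> real" where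
  "dual_norm nrm f = (SUP x\<in>{x. nrm x \<le> 1}. f \<bullet> x)"

definition linear_game ::
  "('a::euclidean_space \<Rightarrow> real) \<Rightarrow> 'a set \<Rightarrow> 'a set \<Rightarrow> ('a \<Rightarrow> 'a \<Rightarrow> real) \<Rightarrow> bool" where
  "linear_game nrm F X loss \<longleftrightarrow>
     is_norm nrm \<and> X = {x. nrm x \<le> 1} \<and> F = {f. dual_norm nrm f \<le> 1} \<and>
     loss = (\<lambda>f x. f \<bullet> x)"

(* Distributions on X are Borel probability measures on the ambient space concentrated on X. *)
definition distributions_on :: "'a::euclidean_space set \<Rightarrow> 'a measure set" where
  "distributions_on X = {p. prob_space p \<and> sets p = sets borel \<and> (AE x in p. x \<in> X)}"

definition rademacher :: "real measure" where
  "rademacher = measure_pmf (pmf_of_set {-1, 1})"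

(* Expectations of norms are taken in [0, \<infinity>], so that Q needs no moment condition.
   On the right-hand side the time-t entries of eps and x are overwritten by the random pair
   (e, z); the given values eps t and x t play no role on either side. *)
definition perturbation_inequality ::
  "('a::euclidean_space \<Rightarrow> real) \<Rightarrow> 'a set \<Rightarrow> nat \<Rightarrow> 'a measure \<Rightarrow> real \<Rightarrow> bool" where
  "perturbation_inequality nrm X T Q C \<longleftrightarrow>
     (\<forall>t\<in>{1..T}. \<forall>(x :: nat \<Rightarrow> 'a) (eps :: nat \<Rightarrow> real).
        (\<forall>i\<in>{1..T} - {t}. x i \<in> X) \<longrightarrow> (\<forall>i\<in>{t+1..T}. eps i \<in> {-1, 1}) \<longrightarrow>
        (SUP p\<in>distributions_on X.
           \<integral>\<^sup>+ z. ennreal (nrm (C *\<^sub>R (\<Sum>i=t+1..T. eps i *\<^sub>R x i) - (\<Sum>i=1..<t. x i)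
                             + (\<integral>y. y \<partial>p) - z)) \<partial>p)
        \<le> (\<integral>\<^sup>+ (e, z). ennreal (nrm (C *\<^sub>R (\<Sum>i=t..T. (eps(t := e)) i *\<^sub>R (x(t := z)) i)
                             - (\<Sum>i=1..<t. x i))) \<partial>(rademacher \<Otimes>\<^sub>M Q)))"

definition perturbation_assumption ::
  "('a::euclidean_space \<Rightarrow> real) \<Rightarrow> 'a set \<Rightarrow> 'a set \<Rightarrow> ('a \<Rightarrow> 'a \<Rightarrow> real) \<Rightarrow> nat
     \<Rightarrow> 'a measure \<Rightarrow> real \<Rightarrow> bool" where
  "perturbation_assumption nrm F X loss T Q C \<longleftrightarrow>
     linear_game nrm F X loss \<and> Q \<in> distributions_on X \<and> 2 \<le> C \<and>
     perturbation_inequality nrm X T Q C"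

definition l1_ball :: "(real ^ 'n) set" where
  "l1_ball = {f. (\<Sum>i\<in>UNIV. \<bar>f $ i\<bar>) \<le> 1}"

definition linf_ball :: "(real ^ 'n) set" where
  "linf_ball = {x. infnorm x \<le> 1}"

definition symmetric_distribution :: "real measure \<Rightarrow> bool" where
  "symmetric_distribution D \<longleftrightarrow> real_distribution D \<and> distr D borel uminus = D"

definition product_distribution :: "real measure \<Rightarrow> (real ^ 'n) measure" where
  "product_distribution D = distr (Pi\<^sub>M (UNIV :: 'n set) (\<lambda>_. D)) borel (\<lambda>f. \<chi> i. f i)"

end

theory Submission
  imports Defs
begin

text \<open>
  Fix \<open>w\<close> and let \<open>a = \<bar>w\<^sub>i\<bar>\<close> be its largest absolute entry. Averaging over the sign reduces the claim to
  \<open>E \<parallel>w + y - z\<parallel> \<le> E \<parallel>w + c x\<parallel>\<close> with \<open>\<bar>c\<bar> = C\<close>, \<open>z\<close> drawn from a distribution with mean \<open>y\<close>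
  and \<open>x\<close> from the product distribution; the left side is at most \<open>a + 2\<close>. Let \<open>m = E \<bar>x\<bar>\<close>, so \<open>C m \<ge> 6\<close>.
  If \<open>a \<le> 4\<close>, then the right side is at least \<open>C m \<ge> 6\<close>.
  If \<open>a > 4\<close> and some other entry exceeds \<open>a - 4\<close> in absolute value, that coordinate is used whenever the
  perturbation decreases the largest entry, and the right side is at least \<open>a + C m / 2 - 1 \<ge> a + 2\<close>.
  Otherwise only coordinate \<open>i\<close> matters on the left and its sign is constant, so the left side is
  \<open>a\<close>, which by Jensen is a lower bound for the right side. If \<open>m = \<infinity>\<close>, the right side is infinite.
\<close>

section \<open>The infinity norm and its dual\<close>

lemma infnorm_le_cart:
  fixes x :: "real ^ 'n"
  shows "infnorm x \<le> b \<longleftrightarrow> (\<forall>i. \<bar>x $ i\<bar> \<le> b)"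
proof
  assume "\<forall>i. \<bar>x $ i\<bar> \<le> b"
  then show "infnorm x \<le> b"
    unfolding infnorm_cart by (intro cSup_least) auto
qed (meson component_le_infnorm_cart order_trans)

lemma borel_measurable_infnorm [measurable]:
  "(infnorm :: 'a::euclidean_space \<Rightarrow> real) \<in> borel_measurable borel"
  by (intro borel_measurable_continuous_onI continuous_on_infnorm continuous_on_id)

lemma is_norm_infnorm: "is_norm (infnorm :: 'a::euclidean_space \<Rightarrow> real)"
  by (auto simp: is_norm_def infnorm_pos_le infnorm_eq_0 infnorm_mul infnorm_triangle)

text \<open>The supremum is attained at the sign vector \<open>?s\<close>, which lies in the cube.
  This identifies \<open>l1_ball\<close> with the dual unit ball demanded by
  \<open>linear_game\<close>.\<close>

lemma dual_norm_infnorm: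
  fixes f :: "real ^ 'n"
  shows "dual_norm infnorm f = (\<Sum>i\<in>UNIV. \<bar>f $ i\<bar>)"
  unfolding dual_norm_def
proof (rule cSup_eq_maximum)
  let ?s = "\<chi> i. sgn (f $ i)"
  have "infnorm ?s \<le> 1"
    by (auto simp: infnorm_le_cart abs_sgn_eq)
  moreover have "f \<bullet> ?s = (\<Sum>i\<in>UNIV. \<bar>f $ i\<bar>)"
    by (simp add: inner_vec_def abs_sgn)
  ultimately show "(\<Sum>i\<in>UNIV. \<bar>f $ i\<bar>) \<in> (\<bullet>) f ` {x. infnorm x \<le> 1}"
    by (metis (mono_tags, lifting) image_eqI mem_Collect_eq)
next
  fix y assume "y \<in> (\<bullet>) f ` {x. infnorm x \<le> 1}"
  then obtain x where x: "\<And>i. \<bar>x $ i\<bar> \<le> 1" and y: "y = f \<bullet> x"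
    by (auto simp: infnorm_le_cart)
  have "f $ i * x $ i \<le> \<bar>f $ i\<bar>" for i
    using mult_left_mono[OF x[of i], of "\<bar>f $ i\<bar>"] abs_le_D1[of "f $ i * x $ i"]
    by (simp add: abs_mult)
  then show "y \<le> (\<Sum>i\<in>UNIV. \<bar>f $ i\<bar>)"
    by (simp add: y inner_vec_def sum_mono)
qed

text \<open>Turns a real minorant with a computable mean into a lower bound for an expectation in
  [0, \<infinity>]. Truncating \<open>g\<close> at 0 can only raise its integral and leaves
  \<open>ennreal (g x)\<close> unchanged.\<close>

lemma integral_le_nn_integral:
  fixes g h :: "'a \<Rightarrow> real"
  assumes "integrable M g" and "\<And>x. x \<in> space M \<Longrightarrow> g x \<le> h x"
  shows "ennreal (\<integral>x. g x \<partial>M) \<le> (\<integral>\<^sup>+x. ennreal (h x) \<partial>M)"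
proof -
  have "ennreal (\<integral>x. g x \<partial>M) \<le> ennreal (\<integral>x. max 0 (g x) \<partial>M)"
    using assms by (intro ennreal_leI integral_mono) auto
  also have "\<dots> = (\<integral>\<^sup>+x. ennreal (max 0 (g x)) \<partial>M)"
    using assms by (intro nn_integral_eq_integral[symmetric]) auto
  also have "\<dots> \<le> (\<integral>\<^sup>+x. ennreal (h x) \<partial>M)"
    using assms(2) by (intro nn_integral_mono) (metis ennreal_max_0' ennreal_leI max.commute)
  finally show ?thesis .
qed

section \<open>Symmetric distributions on the real line\<close>

lemma symmetric_distributionD:
  assumes "symmetric_distribution D"
  shows "prob_space D" "sets D = sets borel" "space D = UNIV" "distr D borel uminus = D"
  using assms real_distribution.events_eq_borel real_distribution.space_eq_univ
  by (auto simp: symmetric_distribution_def real_distribution_def)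

lemma measurable_symmetric_distribution:
  assumes "symmetric_distribution D"
  shows "measurable D N = measurable borel N"
  using symmetric_distributionD(2)[OF assms] by (rule measurable_cong_sets) simp

lemma integral_symmetric_uminus:
  fixes g :: "real \<Rightarrow> real"
  assumes D: "symmetric_distribution D" and g: "g \<in> borel_measurable borel"
  shows "(\<integral>x. g (- x) \<partial>D) = (\<integral>x. g x \<partial>D)"
proof -
  have "(\<integral>x. g x \<partial>distr D borel uminus) = (\<integral>x. g (- x) \<partial>D)"
    using g by (intro integral_distr) (auto simp: measurable_symmetric_distribution[OF D])
  then show ?thesis
    by (simp add: symmetric_distributionD(4)[OF D])
qed

lemma nn_integral_symmetric_uminus:
  assumes D: "symmetric_distribution D" and g: "g \<in> borel_measurable borel"
  shows "(\<integral>\<^sup>+x. g (- x) \<partial>D) = (\<integral>\<^sup>+x. g x \<partial>D)"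
proof -
  have "(\<integral>\<^sup>+x. g x \<partial>distr D borel uminus) = (\<integral>\<^sup>+x. g (- x) \<partial>D)"
    using g by (intro nn_integral_distr) (auto simp: measurable_symmetric_distribution[OF D])
  then show ?thesis
    by (simp add: symmetric_distributionD(4)[OF D])
qed

lemma integral_symmetric_scale:
  fixes g :: "real \<Rightarrow> real"
  assumes D: "symmetric_distribution D" and g: "g \<in> borel_measurable borel"
    and "\<bar>k\<bar> = \<bar>l\<bar>"
  shows "(\<integral>x. g (k * x) \<partial>D) = (\<integral>x. g (l * x) \<partial>D)"
proof (cases "k = l")
  case False
  with assms(3) have "k = - l" by linarith
  then show ?thesis
    using integral_symmetric_uminus[OF D, of "\<lambda>x. g (l * x)"] g by simp
qed simp

lemma integral_pos_part_symmetric: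
  fixes k :: real
  assumes D: "symmetric_distribution D" and i: "integrable D (\<lambda>x. x)"
  shows "(\<integral>x. max 0 (k * x) \<partial>D) = \<bar>k\<bar> * (\<integral>x. \<bar>x\<bar> \<partial>D) / 2"
proof -
  have "(\<integral>x. x \<partial>D) = 0"
    using integral_symmetric_uminus[OF D, of "\<lambda>x. x"] by simp
  \<comment> \<open>The positive part of \<open>u\<close> is \<open>(u + |u|) / 2\<close>, and by
    symmetry the linear half has mean 0.\<close>
  moreover have "max 0 (k * x) = (k / 2) * x + (\<bar>k\<bar> / 2) * \<bar>x\<bar>" for x
    by (simp add: max_def abs_mult[symmetric])
  ultimately show ?thesis using i by simp
qed

text \<open>Averaging over \<open>x\<close> and \<open>- x\<close> eliminates \<open>b\<close>,
  since \<open>2 * |c * x| <= |b + c * x| + |b - c * x|\<close>. Working in [0, \<infinity>] covers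
  an infinite first absolute moment.\<close>

lemma nn_integral_affine_symmetric:
  fixes b c :: real
  assumes D: "symmetric_distribution D"
  shows "ennreal \<bar>c\<bar> * (\<integral>\<^sup>+x. ennreal \<bar>x\<bar> \<partial>D) \<le> (\<integral>\<^sup>+x. ennreal \<bar>b + c * x\<bar> \<partial>D)"
proof -
  note [simp] = measurable_symmetric_distribution[OF D]
  let ?I = "\<integral>\<^sup>+x. ennreal \<bar>b + c * x\<bar> \<partial>D"
  have "2 * (ennreal \<bar>c\<bar> * (\<integral>\<^sup>+x. ennreal \<bar>x\<bar> \<partial>D)) = (\<integral>\<^sup>+x. ennreal (2 * \<bar>c * x\<bar>) \<partial>D)"
    by (simp add: nn_integral_cmult[symmetric] ennreal_mult abs_mult mult.assoc)
  also have "\<dots> \<le> (\<integral>\<^sup>+x. ennreal \<bar>b + c * x\<bar> + ennreal \<bar>b + c * - x\<bar> \<partial>D)"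
    by (intro nn_integral_mono) (simp add: ennreal_plus[symmetric] del: ennreal_plus)
  also have "\<dots> = ?I + (\<integral>\<^sup>+x. ennreal \<bar>b + c * - x\<bar> \<partial>D)"
    by (rule nn_integral_add) simp_all
  also have "(\<integral>\<^sup>+x. ennreal \<bar>b + c * - x\<bar> \<partial>D) = ?I"
    by (rule nn_integral_symmetric_uminus[OF D]) measurable
  finally have "2 * (ennreal \<bar>c\<bar> * (\<integral>\<^sup>+x. ennreal \<bar>x\<bar> \<partial>D)) \<le> 2 * ?I"
    by (simp add: mult_2)
  then show ?thesis
    by (simp add: ennreal_mult_le_mult_iff)
qed

section \<open>The product distribution and independence of its coordinates\<close>

lemma measurable_vec_lambda_PiM:
  assumes "\<And>i. sets (M i) = sets (borel :: real measure)"
  shows "(\<lambda>f. \<chi> i. f i) \<in> borel_measurable (Pi\<^sub>M (UNIV :: 'n::finite set) M)"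
proof (subst borel_measurable_euclidean_space, rule ballI)
  fix b :: "real ^ 'n" assume "b \<in> Basis"
  then obtain i where b: "b = axis i 1"
    by (auto simp: Basis_vec_def)
  have "(\<lambda>f. f i) \<in> borel_measurable (Pi\<^sub>M UNIV M)"
    by (subst measurable_cong_sets[OF refl assms[symmetric]]) (rule measurable_component_singleton, simp)
  then show "(\<lambda>f. (\<chi> i. f i) \<bullet> b) \<in> borel_measurable (Pi\<^sub>M UNIV M)"
    by (simp add: b inner_axis)
qed

lemma sets_product_distribution [simp, measurable_cong]:
  "sets (product_distribution D) = sets borel"
  by (simp add: product_distribution_def)

lemma prob_space_product_distribution:
  assumes "symmetric_distribution D"
  shows "prob_space (product_distribution D :: (real ^ 'n) measure)"
  unfolding product_distribution_def using symmetric_distributionD[OF assms]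
  by (intro prob_space.prob_space_distr prob_space_PiM measurable_vec_lambda_PiM) auto

lemma nn_integral_product_distribution_component:
  assumes D: "symmetric_distribution D" and g: "g \<in> borel_measurable borel"
  shows "(\<integral>\<^sup>+z. g (z $ i) \<partial>(product_distribution D :: (real ^ 'n) measure)) = (\<integral>\<^sup>+x. g x \<partial>D)"
proof -
  have [measurable]: "g \<in> borel_measurable D"
    using g by (simp add: measurable_symmetric_distribution[OF D])
  have "(\<integral>\<^sup>+z. g (z $ i) \<partial>(product_distribution D :: (real ^ 'n) measure))
      = (\<integral>\<^sup>+f. g (f i) \<partial>Pi\<^sub>M (UNIV :: 'n set) (\<lambda>_. D))"
    unfolding product_distribution_def using g symmetric_distributionD[OF D]
    by (subst nn_integral_distr) (auto intro!: measurable_vec_lambda_PiM)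
  also have "\<dots> = (\<integral>\<^sup>+x. g x \<partial>distr (Pi\<^sub>M (UNIV :: 'n set) (\<lambda>_. D)) D (\<lambda>f. f i))"
    by (subst nn_integral_distr) auto
  also have "distr (Pi\<^sub>M (UNIV :: 'n set) (\<lambda>_. D)) D (\<lambda>f. f i) = D"
    using symmetric_distributionD[OF D] by (intro distr_PiM_component) auto
  finally show ?thesis .
qed

text \<open>Padding \<open>g\<close> and \<open>h\<close> with the constant 1 on all other
  coordinates brings both claims under the product rule for integrals over a finite product
  measure.\<close>

lemma
  fixes g h :: "real \<Rightarrow> real" and i j :: "'n::finite"
  assumes D: "symmetric_distribution D" and "i \<noteq> j"
    and g: "integrable D g" and h: "integrable D h"
  shows integrable_product_distribution_mult:
      "integrable (product_distribution D :: (real ^ 'n) measure) (\<lambda>z. g (z $ i) * h (z $ j))"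
    and integral_product_distribution_mult:
      "(\<integral>z. g (z $ i) * h (z $ j) \<partial>(product_distribution D :: (real ^ 'n) measure))
        = (\<integral>x. g x \<partial>D) * (\<integral>x. h x \<partial>D)"
proof -
  note D' = symmetric_distributionD[OF D]
  interpret prob_space D by (fact D'(1))
  interpret product_sigma_finite "\<lambda>_::'n. D" ..
  define F where "F = (\<lambda>k. if k = i then g else if k = j then h else (\<lambda>_. 1))"
  have F: "integrable D (F k)" for k
    using g h by (simp add: F_def)
  have UN: "(UNIV :: 'n set) = insert i (insert j (- {i, j}))" by auto
  \<comment> \<open>\<open>G\<close> stands for evaluation at a point or for integration over
    \<open>D\<close>. Both send the constant function 1 to 1, so the padding factors drop
    out.\<close>
  have prodF: "(\<Prod>k\<in>UNIV. G (F k) k) = G g i * G h j"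
    if "\<And>k. G (\<lambda>_. 1) k = (1::real)" for G
  proof -
    have "(\<Prod>k\<in>UNIV. G (F k) k) = G (F i) i * (G (F j) j * (\<Prod>k\<in>- {i, j}. G (F k) k))"
      using \<open>i \<noteq> j\<close> by (subst UN) simp
    moreover have "(\<Prod>k\<in>- {i, j}. G (F k) k) = 1"
      using that by (intro prod.neutral) (auto simp: F_def)
    ultimately show ?thesis using \<open>i \<noteq> j\<close> by (simp add: F_def)
  qed
  have [measurable]: "g \<in> borel_measurable borel" "h \<in> borel_measurable borel"
    using g h measurable_symmetric_distribution[OF D] by (auto dest: borel_measurable_integrable)
  have m: "(\<lambda>f. \<chi> i. f i) \<in> borel_measurable (Pi\<^sub>M (UNIV :: 'n set) (\<lambda>_. D))"
    by (intro measurable_vec_lambda_PiM D'(2))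
  show "integrable (product_distribution D :: (real ^ 'n) measure) (\<lambda>z. g (z $ i) * h (z $ j))"
    using product_integrable_prod[of UNIV F] F prodF[of "\<lambda>f k. f (_ k)"]
    unfolding product_distribution_def by (subst integrable_distr_eq[OF m]) auto
  show "(\<integral>z. g (z $ i) * h (z $ j) \<partial>(product_distribution D :: (real ^ 'n) measure))
        = (\<integral>x. g x \<partial>D) * (\<integral>x. h x \<partial>D)"
    using product_integral_prod[of UNIV F] F prodF[of "\<lambda>f k. f (_ k)"]
      prodF[of "\<lambda>f k. integral\<^sup>L D f"] prob_space
    unfolding product_distribution_def by (subst integral_distr[OF m]) auto
qed

section \<open>Lower bounds for the expected perturbed norm\<close>

lemma infnorm_expectation_ge_moment:
  fixes w :: "real ^ 'n"
  assumes D: "symmetric_distribution D"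
  shows "ennreal \<bar>c\<bar> * (\<integral>\<^sup>+x. ennreal \<bar>x\<bar> \<partial>D)
    \<le> (\<integral>\<^sup>+z. ennreal (infnorm (w + c *\<^sub>R z)) \<partial>(product_distribution D))"
proof -
  fix i :: 'n
  have "ennreal \<bar>c\<bar> * (\<integral>\<^sup>+x. ennreal \<bar>x\<bar> \<partial>D) \<le> (\<integral>\<^sup>+x. ennreal \<bar>w $ i + c * x\<bar> \<partial>D)"
    by (rule nn_integral_affine_symmetric[OF D])
  also have "\<dots> = (\<integral>\<^sup>+z. ennreal \<bar>w $ i + c * z $ i\<bar> \<partial>(product_distribution D :: (real ^ 'n) measure))"
    by (rule nn_integral_product_distribution_component[OF D, symmetric]) measurable
  also have "\<dots> \<le> (\<integral>\<^sup>+z. ennreal (infnorm (w + c *\<^sub>R z)) \<partial>(product_distribution D))"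
    by (intro nn_integral_mono ennreal_leI order_trans[OF _ component_le_infnorm_cart[where i=i]]) simp
  finally show ?thesis .
qed

text \<open>A case of Jensen's inequality: \<open>|w $ i + c * x|\<close> lies above the affine
  function \<open>|w $ i| + sgn (w $ i) * c * x\<close>, whose mean is \<open>|w $ i|\<close>
  because \<open>D\<close> is centered.\<close>

lemma infnorm_expectation_ge_component:
  fixes w :: "real ^ 'n"
  assumes D: "symmetric_distribution D" and I: "integrable D (\<lambda>x. x)"
  shows "ennreal \<bar>w $ i\<bar> \<le> (\<integral>\<^sup>+z. ennreal (infnorm (w + c *\<^sub>R z)) \<partial>(product_distribution D))"
proof -
  interpret prob_space D by (rule symmetric_distributionD[OF D])
  let ?s = "sgn (w $ i)"
  have "(\<integral>x. x \<partial>D) = 0"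
    using integral_symmetric_uminus[OF D, of "\<lambda>x. x"] by simp
  then have "ennreal \<bar>w $ i\<bar> = ennreal (\<integral>x. \<bar>w $ i\<bar> + ?s * c * x \<partial>D)"
    using I prob_space by simp
  also have "\<dots> \<le> (\<integral>\<^sup>+x. ennreal \<bar>w $ i + c * x\<bar> \<partial>D)"
    using I by (intro integral_le_nn_integral) (auto simp: sgn_if split: if_splits)
  also have "\<dots> = (\<integral>\<^sup>+z. ennreal \<bar>w $ i + c * z $ i\<bar> \<partial>(product_distribution D :: (real ^ 'n) measure))"
    by (rule nn_integral_product_distribution_component[OF D, symmetric]) measurable
  also have "\<dots> \<le> (\<integral>\<^sup>+z. ennreal (infnorm (w + c *\<^sub>R z)) \<partial>(product_distribution D))"
    by (intro nn_integral_mono ennreal_leI order_trans[OF _ component_le_infnorm_cart[where i=i]]) simp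
  finally show ?thesis .
qed

text \<open>Coordinate \<open>j\<close> is the fallback when the perturbation shrinks coordinate
  \<open>i\<close>. Its deficit of at most \<open>d\<close> is paid only if \<open>i\<close> shrinks
  and \<open>j\<close> does not, an event of probability
  \<open>q * (1 - q) <= 1 / 4\<close>.\<close>

lemma infnorm_expectation_ge_two_components:
  fixes w :: "real ^ 'n"
  assumes D: "symmetric_distribution D" and I: "integrable D (\<lambda>x. x)"
    and "i \<noteq> j" and gap: "\<bar>w $ i\<bar> - d \<le> \<bar>w $ j\<bar>" and "0 \<le> d"
  shows "ennreal (\<bar>w $ i\<bar> + \<bar>c\<bar> * (\<integral>x. \<bar>x\<bar> \<partial>D) / 2 - d / 4)
    \<le> (\<integral>\<^sup>+z. ennreal (infnorm (w + c *\<^sub>R z)) \<partial>(product_distribution D))"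
proof -
  let ?Q = "product_distribution D :: (real ^ 'n) measure"
  interpret prob_space D by (rule symmetric_distributionD[OF D])
  interpret Q: prob_space ?Q by (rule prob_space_product_distribution[OF D])
  note [simp] = measurable_symmetric_distribution[OF D]
  define m where "m = (\<integral>x. \<bar>x\<bar> \<partial>D)"
  \<comment> \<open>Unlike \<open>sgn\<close>, \<open>s\<close> is 1 at 0, so \<open>k\<close> and
    \<open>l\<close> have absolute value \<open>|c|\<close> even where an entry of \<open>w\<close>
    vanishes.\<close>
  define s where "s y = (if y < 0 then -1 else 1 :: real)" for y :: real
  define k where "k = s (w $ i) * c"
  define l where "l = s (w $ j) * c"
  have s: "s y * y = \<bar>y\<bar>" "\<bar>s y\<bar> = 1" for y by (auto simp: s_def)
  have kl: "\<bar>k\<bar> = \<bar>c\<bar>" "\<bar>l\<bar> = \<bar>c\<bar>" by (auto simp: k_def l_def abs_mult s)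
  define P where "P k x = max 0 (k * x)" for k x :: real
  define N where "N k x = (if k * x < 0 then 1 else 0 :: real)" for k x :: real
  have P: "integrable D (P k)" "(\<integral>x. P k x \<partial>D) = \<bar>k\<bar> * m / 2" for k
    using I integral_pos_part_symmetric[OF D I] unfolding P_def m_def by auto
  have N: "integrable D (N k)" for k
    unfolding N_def by (rule integrable_const_bound[where B=1]) auto
  \<comment> \<open>The probability of \<open>c * x < 0\<close>, which symmetry makes the same for
    \<open>k\<close> and \<open>l\<close>. It may be below 1/2, since \<open>D\<close> can have an
    atom at 0.\<close>
  define q where "q = (\<integral>x. N c x \<partial>D)"
  have Nq: "(\<integral>x. N k x \<partial>D) = q" if "\<bar>k\<bar> = \<bar>c\<bar>" for k
    unfolding q_def N_def
    by (rule integral_symmetric_scale[OF D _ that, of "\<lambda>y. if y < 0 then 1 else 0"]) measurable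
  \<comment> \<open>For use when coordinate \<open>i\<close> shrinks: \<open>B x\<close> is
    \<open>l * x - d\<close> if \<open>l * x >= 0\<close> and 0 otherwise, while \<open>A x\<close>
    is \<open>min 0 (k * x)\<close>, the loss incurred when both coordinates shrink.\<close>
  define B where "B x = P l x - d * (1 - N l x)" for x
  define A where "A x = - P (- k) x" for x
  have B: "integrable D B" "(\<integral>x. B x \<partial>D) = \<bar>c\<bar> * m / 2 - d * (1 - q)"
    unfolding B_def using P N Nq[OF kl(2)] kl prob_space by auto
  have A: "integrable D A" "(\<integral>x. A x \<partial>D) = - (\<bar>c\<bar> * m / 2)"
    unfolding A_def using P kl by auto
  \<comment> \<open>The constant factor 1 lets the lone term \<open>P k (z $ i)\<close> of
    \<open>H\<close> go through the same product rule.\<close>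
  have one: "integrable D (\<lambda>_. 1 :: real)" "(\<integral>_. 1 \<partial>D) = (1 :: real)"
    using prob_space by auto
  \<comment> \<open>\<open>H\<close> bounds the norm from below through coordinate \<open>i\<close>, except when \<open>k z\<^sub>i < 0 \<le> l z\<^sub>j\<close>, where it uses
    coordinate \<open>j\<close>. It is a sum of products, so independence gives its mean.\<close>
  define H where "H z = \<bar>w $ i\<bar> + P k (z $ i) * 1 + N k (z $ i) * B (z $ j) + A (z $ i) * N l (z $ j)"
    for z :: "real ^ 'n"
  note int = integrable_product_distribution_mult[OF D \<open>i \<noteq> j\<close>]
  note int = int[OF P(1) one(1)] int[OF N B(1)] int[OF A(1) N]
  note val = integral_product_distribution_mult[OF D \<open>i \<noteq> j\<close>]
  note val = val[OF P(1) one(1)] val[OF N B(1)] val[OF A(1) N]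
  have H: "integrable ?Q H"
    unfolding H_def using int by (intro Bochner_Integration.integrable_add) auto
  have "(\<integral>z. H z \<partial>?Q) = \<bar>w $ i\<bar> + \<bar>c\<bar> * m / 2 * 1 + q * (\<bar>c\<bar> * m / 2 - d * (1 - q))
      + (- (\<bar>c\<bar> * m / 2)) * q"
    unfolding H_def using int
    by (simp only: Bochner_Integration.integral_add Bochner_Integration.integrable_add
        Q.integrable_const val A B P N Nq kl one)
       (simp add: Q.prob_space)
  \<comment> \<open>The gain at \<open>j\<close> and the loss at \<open>i\<close> contribute
    \<open>q * |c| * m / 2\<close> with opposite signs and cancel.\<close>
  also have "\<dots> = \<bar>w $ i\<bar> + \<bar>c\<bar> * m / 2 - d * (q * (1 - q))"
    by (simp add: algebra_simps)
  also have "\<dots> \<ge> \<bar>w $ i\<bar> + \<bar>c\<bar> * m / 2 - d * (1 / 4)"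
  proof -
    have "q * (1 - q) \<le> 1 / 4"
      using zero_le_power2[of "q - 1 / 2"] by (simp add: power2_eq_square algebra_simps)
    from mult_left_mono[OF this \<open>0 \<le> d\<close>] show ?thesis by simp
  qed
  finally have "ennreal (\<bar>w $ i\<bar> + \<bar>c\<bar> * m / 2 - d / 4) \<le> ennreal (\<integral>z. H z \<partial>?Q)"
    by (intro ennreal_leI) simp
  also have "\<dots> \<le> (\<integral>\<^sup>+z. ennreal (infnorm (w + c *\<^sub>R z)) \<partial>?Q)"
  proof (rule integral_le_nn_integral[OF H])
    fix z :: "real ^ 'n"
    have comp: "\<bar>w $ i\<bar> + (s (w $ i) * c) * z $ i \<le> infnorm (w + c *\<^sub>R z)" for i
    proof -
      have "\<bar>w $ i\<bar> + (s (w $ i) * c) * z $ i \<le> \<bar>w $ i + c * z $ i\<bar>"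
        by (auto simp: s_def)
      also have "\<dots> \<le> infnorm (w + c *\<^sub>R z)"
        using component_le_infnorm_cart[of "w + c *\<^sub>R z" i] by simp
      finally show ?thesis .
    qed
    have "\<bar>w $ i\<bar> + k * z $ i \<le> infnorm (w + c *\<^sub>R z)"
      "\<bar>w $ i\<bar> - d + l * z $ j \<le> infnorm (w + c *\<^sub>R z)"
      using comp[of i] comp[of j] gap by (auto simp: k_def l_def)
    then show "H z \<le> infnorm (w + c *\<^sub>R z)"
      unfolding H_def A_def B_def P_def N_def by (auto simp: max_def)
  qed
  finally show ?thesis by (simp add: m_def)
qed

section \<open>The centered side, and the comparison for a fixed vector\<close>

lemma centered_deviation_bound:
  fixes w :: "real ^ 'n" and p :: "(real ^ 'n) measure"
  assumes p: "p \<in> distributions_on {x. infnorm x \<le> 1}"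
  shows "(\<integral>\<^sup>+z. ennreal (infnorm (w + (\<integral>y. y \<partial>p) - z)) \<partial>p) \<le> ennreal (infnorm w + 2)"
    and "\<lbrakk>2 \<le> \<bar>w $ i\<bar>; \<And>j. j \<noteq> i \<Longrightarrow> \<bar>w $ j\<bar> + 4 \<le> \<bar>w $ i\<bar>\<rbrakk> \<Longrightarrow>
      (\<integral>\<^sup>+z. ennreal (infnorm (w + (\<integral>y. y \<partial>p) - z)) \<partial>p) \<le> ennreal \<bar>w $ i\<bar>"
proof -
  interpret prob_space p using p by (simp add: distributions_on_def)
  have sets [measurable_cong]: "sets p = sets borel" and ae: "AE z in p. infnorm z \<le> 1"
    using p by (auto simp: distributions_on_def)
  define y where "y = (\<integral>y. y \<partial>p)"
  have intc: "integrable p (\<lambda>z. z $ k)" for k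
    by (rule integrable_const_bound[where B=1])
       (use ae component_le_infnorm_cart[of _ k] in \<open>auto elim!: eventually_mono intro: order_trans\<close>)
  \<comment> \<open>The Euclidean norm is at most the sum of the absolute coordinates, each almost
    surely at most 1.\<close>
  have int: "integrable p (\<lambda>z. z)"
    by (rule integrable_const_bound[where B="real CARD('n)"])
       (use ae in \<open>auto elim!: eventually_mono intro!: order_trans[OF norm_le_l1_cart] sum_bounded_above[THEN order_trans] simp: infnorm_le_cart\<close>)
  have yk: "y $ k = (\<integral>z. z $ k \<partial>p)" for k
    unfolding y_def using integral_bounded_linear[OF bounded_linear_vec_nth int] by simp
  have y: "\<bar>y $ k\<bar> \<le> 1" for k
  proof -
    have b: "AE z in p. \<bar>z $ k\<bar> \<le> 1"
      using ae by eventually_elim (simp add: infnorm_le_cart)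
    have "\<bar>y $ k\<bar> \<le> (\<integral>z. \<bar>z $ k\<bar> \<partial>p)"
      unfolding yk using integral_norm_bound[of p "\<lambda>z. z $ k"] by simp
    also have "\<dots> \<le> (\<integral>z. 1 \<partial>p)"
      using intc b by (intro integral_mono_AE) auto
    finally show ?thesis using prob_space by simp
  qed
  \<comment> \<open>The mean \<open>y\<close> stays in the cube, so \<open>y\<close> and
    \<open>z\<close> move each coordinate by at most 1 apiece.\<close>
  have "(\<integral>\<^sup>+z. ennreal (infnorm (w + y - z)) \<partial>p) \<le> (\<integral>\<^sup>+z. ennreal (infnorm w + 2) \<partial>p)"
  proof (rule nn_integral_mono_AE)
    show "AE z in p. ennreal (infnorm (w + y - z)) \<le> ennreal (infnorm w + 2)"
      using ae
    proof eventually_elim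
      case (elim z)
      have "\<bar>(w + y - z) $ k\<bar> \<le> infnorm w + 2" for k
        using component_le_infnorm_cart[of w k] y[of k] elim[unfolded infnorm_le_cart, rule_format, of k]
        by simp
      then show ?case by (simp add: infnorm_le_cart ennreal_leI)
    qed
  qed
  also have "\<dots> = ennreal (infnorm w + 2)"
    by (simp add: emeasure_space_1)
  finally show "(\<integral>\<^sup>+z. ennreal (infnorm (w + (\<integral>y. y \<partial>p) - z)) \<partial>p) \<le> ennreal (infnorm w + 2)"
    by (simp add: y_def)
  assume wi: "2 \<le> \<bar>w $ i\<bar>" and gap: "\<And>j. j \<noteq> i \<Longrightarrow> \<bar>w $ j\<bar> + 4 \<le> \<bar>w $ i\<bar>"
  \<comment> \<open>As \<open>|y $ i - z $ i| <= 2 <= |w $ i|\<close>, coordinate \<open>i\<close>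
    does not change sign, so its absolute value is this affine function of \<open>z\<close>, with
    mean \<open>|w $ i|\<close>.\<close>
  define h where "h z = \<bar>w $ i\<bar> + sgn (w $ i) * (y $ i - z $ i)" for z :: "real ^ 'n"
  have h: "infnorm (w + y - z) \<le> h z" "0 \<le> h z" if "infnorm z \<le> 1" for z
  proof -
    have z: "\<bar>z $ k\<bar> \<le> 1" for k using that by (simp add: infnorm_le_cart)
    have i: "\<bar>(w + y - z) $ i\<bar> = h z" and g: "\<bar>w $ i\<bar> - 2 \<le> h z"
      using wi y[of i] z[of i] by (auto simp: h_def sgn_if abs_if split: if_splits)
    show "0 \<le> h z" using g wi by simp
    \<comment> \<open>The gap 4 absorbs a shift of 2 in each of the two coordinates:
      \<open>|w $ k| + 2 <= |w $ i| - 2 <= h z\<close>.\<close>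
    have "\<bar>(w + y - z) $ k\<bar> \<le> h z" for k
    proof (cases "k = i")
      case False
      then show ?thesis using gap[of k] y[of k] z[of k] g by simp
    qed (use i in simp)
    then show "infnorm (w + y - z) \<le> h z" by (simp add: infnorm_le_cart)
  qed
  have "(\<integral>\<^sup>+z. ennreal (infnorm (w + y - z)) \<partial>p) \<le> (\<integral>\<^sup>+z. ennreal (h z) \<partial>p)"
    using ae by (intro nn_integral_mono_AE) (auto elim!: eventually_mono intro!: ennreal_leI h)
  also have "\<dots> = ennreal (\<integral>z. h z \<partial>p)"
  proof (rule nn_integral_eq_integral)
    show "integrable p h" unfolding h_def using intc by simp
    show "AE z in p. 0 \<le> h z" using ae by eventually_elim (rule h)
  qed
  also have "(\<integral>z. h z \<partial>p) = \<bar>w $ i\<bar>"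
    unfolding h_def using intc prob_space by (simp add: yk)
  finally show "(\<integral>\<^sup>+z. ennreal (infnorm (w + (\<integral>y. y \<partial>p) - z)) \<partial>p) \<le> ennreal \<bar>w $ i\<bar>"
    by (simp add: y_def)
qed

text \<open>The coefficient \<open>c\<close> is signed so that the bound serves both values of the
  Rademacher variable; stating the moment condition in [0, \<infinity>] includes an infinite
  mean.\<close>

lemma perturbation_bound:
  fixes w :: "real ^ 'n" and p :: "(real ^ 'n) measure"
  assumes D: "symmetric_distribution D" and p: "p \<in> distributions_on {x. infnorm x \<le> 1}"
    and c: "6 \<le> ennreal \<bar>c\<bar> * (\<integral>\<^sup>+x. ennreal \<bar>x\<bar> \<partial>D)"
  shows "(\<integral>\<^sup>+z. ennreal (infnorm (w + (\<integral>y. y \<partial>p) - z)) \<partial>p)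
    \<le> (\<integral>\<^sup>+z. ennreal (infnorm (w + c *\<^sub>R z)) \<partial>(product_distribution D))"
    (is "?L \<le> ?R")
proof (cases "(\<integral>\<^sup>+x. ennreal \<bar>x\<bar> \<partial>D) = \<infinity>")
  case True
  \<comment> \<open>In \<open>ennreal\<close>, \<open>0 * \<infinity> = 0\<close>, so
    \<open>c = 0\<close> would contradict the moment condition.\<close>
  moreover have "c \<noteq> 0" using c by auto
  ultimately have "?R = \<infinity>"
    using infnorm_expectation_ge_moment[OF D, of c w] by (simp add: ennreal_mult_top top_unique)
  then show ?thesis by simp
next
  case False
  have I: "integrable D (\<lambda>x. x)"
    using False by (simp add: integrable_iff_bounded less_top measurable_symmetric_distribution[OF D])
  define m where "m = (\<integral>x. \<bar>x\<bar> \<partial>D)"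
  have m: "(\<integral>\<^sup>+x. ennreal \<bar>x\<bar> \<partial>D) = ennreal m"
    unfolding m_def using I by (intro nn_integral_eq_integral) auto
  have "0 \<le> m" by (simp add: m_def)
  then have "ennreal 6 \<le> ennreal (\<bar>c\<bar> * m)"
    using c by (simp add: m ennreal_mult)
  then have cm: "6 \<le> \<bar>c\<bar> * m"
    using \<open>0 \<le> m\<close> by (subst (asm) ennreal_le_iff) auto
  obtain i where i: "\<And>j. \<bar>w $ j\<bar> \<le> \<bar>w $ i\<bar>"
    using ex_is_arg_min_if_finite[of UNIV "\<lambda>i. - \<bar>w $ i\<bar>"]
    by (auto simp: is_arg_min_def not_less)
  then have wi: "infnorm w \<le> \<bar>w $ i\<bar>" by (simp add: infnorm_le_cart)
  note L = centered_deviation_bound[OF p, of w]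
  consider "\<bar>w $ i\<bar> \<le> 4" | j where "j \<noteq> i" "\<bar>w $ i\<bar> - 4 \<le> \<bar>w $ j\<bar>"
    | "4 < \<bar>w $ i\<bar>" "\<And>j. j \<noteq> i \<Longrightarrow> \<bar>w $ j\<bar> + 4 \<le> \<bar>w $ i\<bar>"
    by (metis diff_le_eq linorder_not_less order.strict_implies_order)
  then show ?thesis
  proof cases
    case 1
    have "?L \<le> ennreal 6"
      using L(1) wi 1 by (elim order_trans) (simp add: ennreal_leI del: ennreal_numeral)
    also have "\<dots> \<le> ennreal \<bar>c\<bar> * (\<integral>\<^sup>+x. ennreal \<bar>x\<bar> \<partial>D)"
      using c by simp
    also have "\<dots> \<le> ?R" by (rule infnorm_expectation_ge_moment[OF D])
    finally show ?thesis .
  next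
    case 2
    \<comment> \<open>The deduction \<open>4 / 4\<close> is \<open>d / 4\<close> with
      \<open>d = 4\<close>. From \<open>|c| * m >= 6\<close> there remains \<open>3 - 1 = 2\<close>,
      exactly the allowance in \<open>L(1)\<close>.\<close>
    have "?L \<le> ennreal (\<bar>w $ i\<bar> + \<bar>c\<bar> * m / 2 - 4 / 4)"
      using wi cm by (intro order_trans[OF L(1)] ennreal_leI) simp
    also have "\<dots> \<le> ?R"
      unfolding m_def using 2
      by (intro infnorm_expectation_ge_two_components[OF D I]) auto
    finally show ?thesis .
  next
    case 3
    then have "?L \<le> ennreal \<bar>w $ i\<bar>" by (intro L(2)) auto
    also have "\<dots> \<le> ?R" by (rule infnorm_expectation_ge_component[OF D I])
    finally show ?thesis .
  qed
qed

section \<open>Averaging over the sign, and the conclusion\<close>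

lemma nn_integral_rademacher_pair:
  assumes "sigma_finite_measure Q" and g: "(\<lambda>(e, z). g e z) \<in> borel_measurable (borel \<Otimes>\<^sub>M Q)"
  shows "(\<integral>\<^sup>+(e, z). g e z \<partial>(rademacher \<Otimes>\<^sub>M Q))
    = ((\<integral>\<^sup>+z. g (-1) z \<partial>Q) + (\<integral>\<^sup>+z. g 1 z \<partial>Q)) / 2"
proof -
  interpret sigma_finite_measure Q by fact
  \<comment> \<open>Every set is measurable for \<open>rademacher\<close>, so the identity into the
    Borel reals is measurable and the measurability of \<open>g\<close> carries over.\<close>
  have "(\<lambda>x. (fst x, snd x)) \<in> measurable (rademacher \<Otimes>\<^sub>M Q) (borel \<Otimes>\<^sub>M Q)"
  proof (rule measurable_Pair)
    have "(\<lambda>x. x) \<in> borel_measurable rademacher"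
      by (simp add: rademacher_def)
    then show "fst \<in> borel_measurable (rademacher \<Otimes>\<^sub>M Q)"
      by (rule measurable_fst'')
  qed simp
  from measurable_compose[OF this g]
  have "(\<lambda>(e, z). g e z) \<in> borel_measurable (rademacher \<Otimes>\<^sub>M Q)"
    by (simp add: case_prod_beta')
  from nn_integral_fst[OF this]
  have "(\<integral>\<^sup>+(e, z). g e z \<partial>(rademacher \<Otimes>\<^sub>M Q)) = (\<integral>\<^sup>+e. (\<integral>\<^sup>+z. g e z \<partial>Q) \<partial>rademacher)"
    by simp
  also have "\<dots> = ((\<integral>\<^sup>+z. g (-1) z \<partial>Q) + (\<integral>\<^sup>+z. g 1 z \<partial>Q)) / 2"
    by (simp add: rademacher_def nn_integral_pmf_of_set add.commute)
  finally show ?thesis .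
qed

theorem lemma13:
  fixes D :: "real measure" and C :: real and T :: nat
    and F X :: "(real ^ 'n) set" and loss :: "real ^ 'n \<Rightarrow> real ^ 'n \<Rightarrow> real"
  assumes "F = l1_ball" and "X = linf_ball" and "loss = (\<lambda>f x. f \<bullet> x)"
    and "symmetric_distribution D"
    and "0 < C" and "6 / (\<integral>\<^sup>+ x. ennreal \<bar>x\<bar> \<partial>D) \<le> ennreal C"
  shows "linear_game infnorm F X loss \<and>
    perturbation_inequality infnorm X T (product_distribution D) C \<and>
    ((AE x in D. \<bar>x\<bar> \<le> 1) \<longrightarrow>
       perturbation_assumption infnorm F X loss T (product_distribution D) C)"
proof -
  note D = \<open>symmetric_distribution D\<close>
  let ?Q = "product_distribution D :: (real ^ 'n) measure"
  let ?m = "\<integral>\<^sup>+ x. ennreal \<bar>x\<bar> \<partial>D"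
  interpret Q: prob_space ?Q by (rule prob_space_product_distribution[OF D])
  have game: "linear_game infnorm F X loss"
    using assms(1-3)
    by (simp add: linear_game_def is_norm_infnorm dual_norm_infnorm l1_ball_def linf_ball_def)
  \<comment> \<open>In \<open>ennreal\<close>, \<open>6 / 0 = top\<close>, so a zero moment
    contradicts the bound by the finite \<open>ennreal C\<close>; for an infinite moment,
    \<open>0 < C\<close> makes the product \<open>top\<close>. Otherwise the moment cancels.\<close>
  have C: "6 \<le> ennreal C * ?m"
  proof (cases "?m = 0 \<or> ?m = top")
    case True
    then show ?thesis
      using assms(5,6) by (auto simp: ennreal_mult_top top_unique)
  next
    case False
    then have "?m / ?m = 1"
      by (intro ennreal_divide_self) (simp_all add: top.not_eq_extremum)
    then have "6 = 6 / ?m * ?m"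
      by (simp add: ennreal_divide_times)
    also have "\<dots> \<le> ennreal C * ?m"
      by (intro mult_right_mono assms(6)) simp
    finally show ?thesis .
  qed
  have "perturbation_inequality infnorm X T ?Q C"
    unfolding perturbation_inequality_def
  proof (intro ballI allI impI SUP_least)
    fix t and x :: "nat \<Rightarrow> real ^ 'n" and eps :: "nat \<Rightarrow> real" and p
    assume t: "t \<in> {1..T}" and p: "p \<in> distributions_on X"
    define w where "w = C *\<^sub>R (\<Sum>i=t+1..T. eps i *\<^sub>R x i) - (\<Sum>i=1..<t. x i)"
    let ?L = "\<integral>\<^sup>+z. ennreal (infnorm (w + (\<integral>y. y \<partial>p) - z)) \<partial>p"
    \<comment> \<open>Overwriting at \<open>t\<close> affects only the first summand, which exists
      because \<open>t <= T\<close>.\<close>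
    have "(\<Sum>i=t..T. (eps(t := e)) i *\<^sub>R (x(t := z)) i)
        = e *\<^sub>R z + (\<Sum>i=t+1..T. eps i *\<^sub>R x i)" for e z
      using t by (subst sum.atLeast_Suc_atMost) (auto intro!: sum.cong)
    then have "(\<integral>\<^sup>+(e, z). ennreal (infnorm (C *\<^sub>R (\<Sum>i=t..T. (eps(t := e)) i *\<^sub>R (x(t := z)) i)
          - (\<Sum>i=1..<t. x i))) \<partial>(rademacher \<Otimes>\<^sub>M ?Q))
        = (\<integral>\<^sup>+(e, z). ennreal (infnorm (w + (C * e) *\<^sub>R z)) \<partial>(rademacher \<Otimes>\<^sub>M ?Q))"
      by (simp add: w_def algebra_simps)
    also have "\<dots> = ((\<integral>\<^sup>+z. ennreal (infnorm (w + (C * -1) *\<^sub>R z)) \<partial>?Q)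
        + (\<integral>\<^sup>+z. ennreal (infnorm (w + (C * 1) *\<^sub>R z)) \<partial>?Q)) / 2"
      by (intro nn_integral_rademacher_pair Q.sigma_finite_measure_axioms) measurable
    \<comment> \<open>The bound is used with \<open>c = - C\<close> and with \<open>c = C\<close>,
      both of absolute value \<open>C\<close>.\<close>
    also have "\<dots> \<ge> (?L + ?L) / 2"
      using p C \<open>0 < C\<close> assms(2)
      by (intro divide_right_mono_ennreal add_mono perturbation_bound[OF D])
         (auto simp: linf_ball_def)
    also have "(?L + ?L) / 2 = ?L"
      by (simp add: mult_2[symmetric] mult.commute[of 2] mult_divide_eq_ennreal)
    finally show "(\<integral>\<^sup>+z. ennreal (infnorm (C *\<^sub>R (\<Sum>i=t+1..T. eps i *\<^sub>R x i) - (\<Sum>i=1..<t. x i)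
          + (\<integral>y. y \<partial>p) - z)) \<partial>p)
        \<le> (\<integral>\<^sup>+(e, z). ennreal (infnorm (C *\<^sub>R (\<Sum>i=t..T. (eps(t := e)) i *\<^sub>R (x(t := z)) i)
          - (\<Sum>i=1..<t. x i))) \<partial>(rademacher \<Otimes>\<^sub>M ?Q))"
      by (simp add: w_def)
  qed
  \<comment> \<open>Support in [-1, 1] puts \<open>?Q\<close> on the cube and bounds the first
    absolute moment by 1, which forces \<open>6 <= C\<close>.\<close>
  moreover have "?Q \<in> distributions_on X \<and> 2 \<le> C" if ae: "AE x in D. \<bar>x\<bar> \<le> 1"
  proof
    interpret D: prob_space D by (rule symmetric_distributionD[OF D])
    note m = measurable_vec_lambda_PiM[where 'n='n, OF symmetric_distributionD(2)[OF D]]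
    have "AE f in Pi\<^sub>M (UNIV :: 'n set) (\<lambda>_. D). \<forall>i. \<bar>f i\<bar> \<le> 1"
      unfolding AE_all_countable
      by (intro allI AE_PiM_component[OF D.prob_space_axioms UNIV_I ae])
    then have "AE z in ?Q. infnorm z \<le> 1"
      unfolding product_distribution_def by (subst AE_distr_iff[OF m]) (auto simp: infnorm_le_cart)
    then show "?Q \<in> distributions_on X"
      using Q.prob_space_axioms assms(2) by (simp add: distributions_on_def linf_ball_def)
    have "?m \<le> (\<integral>\<^sup>+ x. 1 \<partial>D)"
      using ae by (intro nn_integral_mono_AE) auto
    then have "?m \<le> 1" by (simp add: D.emeasure_space_1)
    then have "ennreal C * ?m \<le> ennreal C * 1"
      by (rule mult_left_mono) simp
    with C have "6 \<le> C"
      using order_trans by force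
    then show "2 \<le> C" by simp
  qed
  ultimately show ?thesis
    using game by (simp add: perturbation_assumption_def)
qed

end
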